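(* Let $\mathbb{P}_{\mathfrak{p}}=\langle\{\phi\},\chi,\mathsf{H},\mathbb{E},\mathfrak{p}\rangle$ be a probabilistic abduction problem, $\mathbf{V}$ the set of variables occurring in it, and $\tau$ an $\mathcal{L}_{\mathsf{CPL}}$-term built from literals in $\mathsf{H}$. Then: (1) $\tau$ is a solution to $\mathbb{P}_{\mathfrak{p}}$ iff $\Xi_{\mathfrak{p}}\cup\{\neg\triangle\neg\mathsf{Pr}(\phi\wedge\tau)\}\not\models_{\mathsf{FP}}\bot$ and $\mathsf{FP}\models\mathsf{Pr}(\phi\wedge\tau)\rightarrow\mathsf{Pr}(\chi)$; (2) $\tau$ is a preferred solution to $\mathbb{P}_{\mathfrak{p}}$ iff the two conditions of (1) hold and, in addition, $\Xi_{\mathfrak{p}}\cup\{\mathsf{Pr}(\sigma)\rightarrow\mathsf{Pr}(\tau)\}\not\models_{\mathsf{FP}}\bot$ for every solution $\sigma$ to $\mathbb{P}_{\mathfrak{p}}$.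
   Context: $\mathcal{L}_{\mathsf{CPL}}$ is the set of classical propositional formulas over a countable set of variables built with $\neg,\wedge,\vee$, with classical entailment $\models_{\mathsf{CPL}}$; an $\mathcal{L}_{\mathsf{CPL}}$-term is a conjunction of literals. Language $\mathcal{L}^{\mathbb{Q}}_{\mathsf{Pr}}$ of FP: $\alpha ::= \mathsf{Pr}(\psi)\mid \mathsf{Pr}(\psi)\diamond\overline{c}\mid\neg\alpha\mid\triangle\alpha\mid\alpha\odot\alpha\mid\alpha\oplus\alpha\mid\alpha\rightarrow\alpha$ with $\psi\in\mathcal{L}_{\mathsf{CPL}}$, $c\in\mathbb{Q}\cap[0,1]$, $\diamond\in\{\le,<,>,\ge\}$. A probabilistic model for a finite $\mathbf{V}$ is $\mathfrak{M}=\langle 2^{\mathbf{V}},\mu\rangle$ with $\mu$ a probability measure on the power set of $2^{\mathbf{V}}$; $\|p\|=\{X\subseteq\mathbf{V}:p\in X\}$, $\|\neg\psi\|$ complement, $\|\psi\wedge\psi'\|$ intersection, $\|\psi\vee\psi'\|$ union. Interpretation: $\mathcal{I}_{\mathfrak{M}}(\mathsf{Pr}(\psi))=\mu(\|\psi\|)$; $\mathcal{I}_{\mathfrak{M}}(\mathsf{Pr}(\psi)\diamond\overline{c})=1$ if $\mu(\|\psi\|)\diamond c$, else $0$; $\mathcal{I}(\neg\alpha)=1-\mathcal{I}(\alpha)$; $\mathcal{I}(\triangle\alpha)=1$ if $\mathcal{I}(\alpha)=1$ else $0$; $\mathcal{I}(\alpha\odot\beta)=\max(0,\mathcal{I}(\alpha)+\mathcal{I}(\beta)-1)$;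 $\mathcal{I}(\alpha\oplus\beta)=\min(1,\mathcal{I}(\alpha)+\mathcal{I}(\beta))$; $\mathcal{I}(\alpha\rightarrow\beta)=\min(1,1-\mathcal{I}(\alpha)+\mathcal{I}(\beta))$. $\Gamma\models_{\mathsf{FP}}\bot$ means no probabilistic model (for the variables of $\Gamma$) gives value $1$ to all of $\Gamma$; $\mathsf{FP}\models\alpha$ means $\alpha$ has value $1$ in every probabilistic model. $\mathsf{Pr}(\psi)\approx\overline{c}$ abbreviates $(\mathsf{Pr}(\psi)\ge\overline{c})\odot(\mathsf{Pr}(\psi)\le\overline{c})$. A probabilistic abduction problem (PrAP) is $\mathbb{P}_{\mathfrak{p}}=\langle\Phi,\chi,\mathsf{H},\mathbb{E},\mathfrak{p}\rangle$ where $\Phi\cup\{\chi\}\cup\mathbb{E}\subseteq\mathcal{L}_{\mathsf{CPL}}$ is finite, the variables of $\mathbb{E}$ occur in $\Phi\cup\{\chi\}$, $\mathsf{H}$ is a finite set of literals whose variables occur in $\Phi\cup\{\chi\}$, and $\mathfrak{p}:\mathbb{E}\to[0,1]\cap\mathbb{Q}$. $\mu$ (on $2^{\mathbf{V}}$) is coherent with $\mathfrak{p}$ iff $\mu(\|\psi\|)=\mathfrak{p}(\psi)$ for all $\psi\in\mathbb{E}$. For $\Phi=\{\phi\}$: a solution is an $\mathcal{L}_{\mathsf{CPL}}$-term $\tau$ built from literals in $\mathsf{H}$ with $\phi,\tau\models_{\mathsf{CPL}}\chi$ such that some model $\langle 2^{\mathbf{V}},\mu\rangle$ with $\mu$ coherent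 with $\mathfrak{p}$ has $\mu(\|\phi\wedge\tau\|)>0$; a solution $\tau$ is preferred iff for every other solution $\sigma$ there is a model $\langle 2^{\mathbf{V}},\mu\rangle$ with $\mu$ coherent with $\mathfrak{p}$ and $\mu(\|\tau\|)\ge\mu(\|\sigma\|)$. The FP-counterpart of $\mathfrak{p}$ is $\Xi_{\mathfrak{p}}=\{\mathsf{Pr}(\psi)\approx\overline{c}:\psi\in\mathbb{E},\ \mathfrak{p}(\psi)=c\}$. *)

theory Defs
  imports "HOL-Probability.Probability_Measure" "HOL-Library.Countable"
begin

datatype (cpl_vars: 'v) cpl =
    Var 'v
  | Neg "'v cpl"
  | And "'v cpl" "'v cpl"
  | Or "'v cpl" "'v cpl"

primrec cpl_sat :: "('v \<Rightarrow> bool) \<Rightarrow> 'v cpl \<Rightarrow> bool" where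
  "cpl_sat v (Var p) \<longleftrightarrow> v p"
| "cpl_sat v (Neg \<psi>) \<longleftrightarrow> \<not> cpl_sat v \<psi>"
| "cpl_sat v (And \<psi> \<psi>') \<longleftrightarrow> cpl_sat v \<psi> \<and> cpl_sat v \<psi>'"
| "cpl_sat v (Or \<psi> \<psi>') \<longleftrightarrow> cpl_sat v \<psi> \<or> cpl_sat v \<psi>'"

definition cpl_entails :: "'v cpl set \<Rightarrow> 'v cpl \<Rightarrow> bool" where
  "cpl_entails \<Gamma> \<psi> \<longleftrightarrow> (\<forall>v. (\<forall>\<gamma>\<in>\<Gamma>. cpl_sat v \<gamma>) \<longrightarrow> cpl_sat v \<psi>)"

definition is_literal :: "'v cpl \<Rightarrow> bool" where
  "is_literal l \<longleftrightarrow> (\<exists>p. l = Var p \<or> l = Neg (Var p))"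

text \<open>Terms are non-empty conjunctions: the language has no constant for truth.\<close>

inductive term_over :: "'v cpl set \<Rightarrow> 'v cpl \<Rightarrow> bool" for H where
  lit: "l \<in> H \<Longrightarrow> is_literal l \<Longrightarrow> term_over H l"
| conj: "term_over H \<sigma> \<Longrightarrow> term_over H \<tau> \<Longrightarrow> term_over H (And \<sigma> \<tau>)"

typedef unit_rat = "{c :: rat. 0 \<le> c \<and> c \<le> 1}"
  morphisms rat_of_unit unit_of_rat
  by (intro exI[of _ 0]) simp

definition real_of_unit :: "unit_rat \<Rightarrow> real" where
  "real_of_unit c = real_of_rat (rat_of_unit c)"

datatype cmp = Le | Less | Greater | Ge

primrec cmp_holds :: "cmp \<Rightarrow> real \<Rightarrow> real \<Rightarrow> bool" where
  "cmp_holds Le x y \<longleftrightarrow> x \<le> y"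
| "cmp_holds Less x y \<longleftrightarrow> x < y"
| "cmp_holds Greater x y \<longleftrightarrow> x > y"
| "cmp_holds Ge x y \<longleftrightarrow> x \<ge> y"

datatype (fp_vars: 'v) fp =
    Pr "'v cpl"
  | PrCmp "'v cpl" cmp unit_rat
  | FNeg "'v fp"
  | Delta "'v fp"
  | SConj "'v fp" "'v fp"
  | SDisj "'v fp" "'v fp"
  | Impl "'v fp" "'v fp"

definition prob_model :: "'v set \<Rightarrow> 'v set measure \<Rightarrow> bool" where
  "prob_model V M \<longleftrightarrow>
     finite V \<and> space M = Pow V \<and> sets M = Pow (Pow V) \<and> prob_space M"

primrec cpl_ext :: "'v set \<Rightarrow> 'v cpl \<Rightarrow> 'v set set" where
  "cpl_ext V (Var p) = {X. X \<subseteq> V \<and> p \<in> X}"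
| "cpl_ext V (Neg \<psi>) = Pow V - cpl_ext V \<psi>"
| "cpl_ext V (And \<psi> \<psi>') = cpl_ext V \<psi> \<inter> cpl_ext V \<psi>'"
| "cpl_ext V (Or \<psi> \<psi>') = cpl_ext V \<psi> \<union> cpl_ext V \<psi>'"

primrec fp_val :: "'v set \<Rightarrow> 'v set measure \<Rightarrow> 'v fp \<Rightarrow> real" where
  "fp_val V M (Pr \<psi>) = measure M (cpl_ext V \<psi>)"
| "fp_val V M (PrCmp \<psi> d c) =
     (if cmp_holds d (measure M (cpl_ext V \<psi>)) (real_of_unit c) then 1 else 0)"
| "fp_val V M (FNeg \<alpha>) = 1 - fp_val V M \<alpha>"
| "fp_val V M (Delta \<alpha>) = (if fp_val V M \<alpha> = 1 then 1 else 0)"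
| "fp_val V M (SConj \<alpha> \<beta>) = max 0 (fp_val V M \<alpha> + fp_val V M \<beta> - 1)"
| "fp_val V M (SDisj \<alpha> \<beta>) = min 1 (fp_val V M \<alpha> + fp_val V M \<beta>)"
| "fp_val V M (Impl \<alpha> \<beta>) = min 1 (1 - fp_val V M \<alpha> + fp_val V M \<beta>)"

text \<open>Models are over finitely many variables, so this is meaningful only if finitely many
  variables occur in \<open>\<Gamma>\<close>.\<close>

definition fp_entails_bot :: "'v fp set \<Rightarrow> bool" where
  "fp_entails_bot \<Gamma> \<longleftrightarrow>
     \<not> (\<exists>M. prob_model (\<Union>\<alpha>\<in>\<Gamma>. fp_vars \<alpha>) M \<and>
            (\<forall>\<alpha>\<in>\<Gamma>. fp_val (\<Union>\<alpha>\<in>\<Gamma>. fp_vars \<alpha>) M \<alpha> = 1))"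

definition fp_valid :: "'v fp \<Rightarrow> bool" where
  "fp_valid \<alpha> \<longleftrightarrow> (\<forall>V M. prob_model V M \<and> fp_vars \<alpha> \<subseteq> V \<longrightarrow> fp_val V M \<alpha> = 1)"

definition PrEq :: "'v cpl \<Rightarrow> unit_rat \<Rightarrow> 'v fp" where
  "PrEq \<psi> c = SConj (PrCmp \<psi> Ge c) (PrCmp \<psi> Le c)"

text \<open>Probability assignments are total functions of which only the values on \<open>E\<close> matter.\<close>

definition prap ::
  "'v cpl set \<Rightarrow> 'v cpl \<Rightarrow> 'v cpl set \<Rightarrow> 'v cpl set \<Rightarrow> ('v cpl \<Rightarrow> unit_rat) \<Rightarrow> bool" where
  "prap \<Phi> chi H E p \<longleftrightarrow>
     finite \<Phi> \<and> finite E \<and> finite H \<and> (\<forall>l\<in>H. is_literal l) \<and>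
     (\<Union>\<psi>\<in>E. cpl_vars \<psi>) \<subseteq> (\<Union>\<psi>\<in>\<Phi> \<union> {chi}. cpl_vars \<psi>) \<and>
     (\<Union>l\<in>H. cpl_vars l) \<subseteq> (\<Union>\<psi>\<in>\<Phi> \<union> {chi}. cpl_vars \<psi>)"

definition prap_vars :: "'v cpl set \<Rightarrow> 'v cpl \<Rightarrow> 'v cpl set \<Rightarrow> 'v cpl set \<Rightarrow> 'v set" where
  "prap_vars \<Phi> chi H E = (\<Union>\<psi>\<in>\<Phi> \<union> {chi} \<union> H \<union> E. cpl_vars \<psi>)"

definition coherent ::
  "'v set \<Rightarrow> 'v set measure \<Rightarrow> 'v cpl set \<Rightarrow> ('v cpl \<Rightarrow> unit_rat) \<Rightarrow> bool" where
  "coherent V M E p \<longleftrightarrow> (\<forall>\<psi>\<in>E. measure M (cpl_ext V \<psi>) = real_of_unit (p \<psi>))"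

definition prap_solution ::
  "'v cpl \<Rightarrow> 'v cpl \<Rightarrow> 'v cpl set \<Rightarrow> 'v cpl set \<Rightarrow> ('v cpl \<Rightarrow> unit_rat) \<Rightarrow> 'v cpl \<Rightarrow> bool" where
  "prap_solution \<phi> chi H E p \<tau> \<longleftrightarrow>
     (let V = prap_vars {\<phi>} chi H E in
      term_over H \<tau> \<and> cpl_entails {\<phi>, \<tau>} chi \<and>
      (\<exists>M. prob_model V M \<and> coherent V M E p \<and> measure M (cpl_ext V (And \<phi> \<tau>)) > 0))"

definition prap_preferred ::
  "'v cpl \<Rightarrow> 'v cpl \<Rightarrow> 'v cpl set \<Rightarrow> 'v cpl set \<Rightarrow> ('v cpl \<Rightarrow> unit_rat) \<Rightarrow> 'v cpl \<Rightarrow> bool" where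
  "prap_preferred \<phi> chi H E p \<tau> \<longleftrightarrow>
     (let V = prap_vars {\<phi>} chi H E in
      prap_solution \<phi> chi H E p \<tau> \<and>
      (\<forall>\<sigma>. prap_solution \<phi> chi H E p \<sigma> \<and> \<sigma> \<noteq> \<tau> \<longrightarrow>
        (\<exists>M. prob_model V M \<and> coherent V M E p \<and>
             measure M (cpl_ext V \<tau>) \<ge> measure M (cpl_ext V \<sigma>))))"

definition fp_counterpart :: "'v cpl set \<Rightarrow> ('v cpl \<Rightarrow> unit_rat) \<Rightarrow> 'v fp set" where
  "fp_counterpart E p = {PrEq \<psi> c | \<psi> c. \<psi> \<in> E \<and> p \<psi> = c}"

end

theory Submission
  imports Defs "HOL-Probability.Giry_Monad"
begin

text \<open>Pushing a measure on \<open>2^V\<close> forward along \<open>X \<mapsto> X \<inter> W\<close> preserves the probability of every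
  formula over \<open>V \<inter> W\<close>. Hence satisfiability of a set of FP-formulas does not depend on the finite
  set of variables chosen, and the models over the variables of \<open>\<Gamma>\<close> may be traded for models over
  the variables of the abduction problem. Validity of \<open>Pr a \<rightarrow> Pr b\<close> is classical entailment, since a
  refuting valuation yields a refuting point mass.\<close>

lemma cpl_sat_cong:
  "(\<And>x. x \<in> cpl_vars \<psi> \<Longrightarrow> v x = w x) \<Longrightarrow> cpl_sat v \<psi> \<longleftrightarrow> cpl_sat w \<psi>"
  by (induction \<psi>) auto

lemma cpl_ext_eq_sat: "cpl_ext V \<psi> = {X. X \<subseteq> V \<and> cpl_sat (\<lambda>x. x \<in> X) \<psi>}"
  by (induction \<psi>) auto

lemma finite_cpl_vars: "finite (cpl_vars \<psi>)"
  by (induction \<psi>) auto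

lemma cpl_vars_term_over:
  "term_over H \<tau> \<Longrightarrow> cpl_vars \<tau> \<subseteq> (\<Union>l\<in>H. cpl_vars l)"
  by (induction rule: term_over.induct) auto

text \<open>\<open>count_space\<close> makes every subset of \<open>Pow W\<close> measurable, as
  \<open>prob_model\<close> demands. No inclusion between the two variable sets is required:
  variables outside \<open>W\<close> are forgotten, and those of \<open>W\<close> missing from the
  old model become false almost surely.\<close>

definition transfer_model :: "'v set \<Rightarrow> 'v set measure \<Rightarrow> 'v set measure" where
  "transfer_model W M = distr M (count_space (Pow W)) (\<lambda>X. X \<inter> W)"

lemma measurable_transfer:
  assumes "prob_model V M"
  shows "(\<lambda>X. X \<inter> W) \<in> measurable M (count_space (Pow W))"
proof (rule measurableI)
  fix A :: "'a set set"
  show "(\<lambda>X. X \<inter> W) -` A \<inter> space M \<in> sets M"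
    using assms by (auto simp: prob_model_def)
qed auto

lemma prob_model_transfer:
  assumes "prob_model V M" "finite W"
  shows "prob_model W (transfer_model W M)"
  using assms prob_space.prob_space_distr[OF _ measurable_transfer[OF assms(1)]]
  by (auto simp: prob_model_def transfer_model_def)

text \<open>A valuation \<open>X\<close> and its restriction \<open>X \<inter> W\<close> agree on
  the variables of \<psi>, so the preimage of the extension over \<open>W\<close> is exactly the
  extension over \<open>V\<close>.\<close>

lemma measure_transfer:
  assumes M: "prob_model V M" and vars: "cpl_vars \<psi> \<subseteq> V \<inter> W"
  shows "measure (transfer_model W M) (cpl_ext W \<psi>) = measure M (cpl_ext V \<psi>)"
proof -
  have "cpl_sat (\<lambda>x. x \<in> X \<inter> W) \<psi> \<longleftrightarrow> cpl_sat (\<lambda>x. x \<in> X) \<psi>" for X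
    by (rule cpl_sat_cong) (use vars in auto)
  then have "(\<lambda>X. X \<inter> W) -` cpl_ext W \<psi> \<inter> space M = cpl_ext V \<psi>"
    using M by (auto simp: cpl_ext_eq_sat prob_model_def)
  moreover have "cpl_ext W \<psi> \<in> sets (count_space (Pow W))"
    by (auto simp: cpl_ext_eq_sat)
  ultimately show ?thesis
    unfolding transfer_model_def by (simp add: measure_distr measurable_transfer[OF M])
qed

lemma fp_val_transfer:
  assumes "prob_model V M" "fp_vars \<alpha> \<subseteq> V \<inter> W"
  shows "fp_val W (transfer_model W M) \<alpha> = fp_val V M \<alpha>"
  using assms(2) by (induction \<alpha>) (auto simp: measure_transfer[OF assms(1)])

lemma not_fp_entails_bot_iff:
  assumes "finite V" and vars: "(\<Union>\<alpha>\<in>\<Gamma>. fp_vars \<alpha>) \<subseteq> V"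
  shows "\<not> fp_entails_bot \<Gamma> \<longleftrightarrow> (\<exists>M. prob_model V M \<and> (\<forall>\<alpha>\<in>\<Gamma>. fp_val V M \<alpha> = 1))"
proof -
  \<comment> \<open>Both variable sets are left arbitrary because the step is used twice: from the
    variables of \<Gamma> to \<open>V\<close>, and back.\<close>
  have step: "\<exists>M. prob_model Y M \<and> (\<forall>\<alpha>\<in>\<Gamma>. fp_val Y M \<alpha> = 1)"
    if M: "prob_model X M" "\<forall>\<alpha>\<in>\<Gamma>. fp_val X M \<alpha> = 1"
      and Y: "finite Y" "\<And>\<alpha>. \<alpha> \<in> \<Gamma> \<Longrightarrow> fp_vars \<alpha> \<subseteq> X \<inter> Y" for X Y M
  proof (intro exI conjI ballI)
    show "prob_model Y (transfer_model Y M)"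
      by (rule prob_model_transfer[OF M(1) Y(1)])
    show "fp_val Y (transfer_model Y M) \<alpha> = 1" if "\<alpha> \<in> \<Gamma>" for \<alpha>
      using fp_val_transfer[OF M(1) Y(2)[OF that]] M(2) that by simp
  qed
  let ?W = "\<Union>\<alpha>\<in>\<Gamma>. fp_vars \<alpha>"
  have "finite ?W"
    using vars assms(1) by (rule finite_subset)
  then show ?thesis
    unfolding fp_entails_bot_def not_not
    using step[of ?W _ V] step[of V _ ?W] assms by blast
qed

text \<open>Both comparisons are two-valued, and on 0 and 1 the strong conjunction is classical
  conjunction.\<close>

lemma fp_val_PrEq:
  "fp_val V M (PrEq \<psi> c) = 1 \<longleftrightarrow> measure M (cpl_ext V \<psi>) = real_of_unit c"
  by (auto simp: PrEq_def)

lemma fp_val_fp_counterpart: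
  "(\<forall>\<alpha>\<in>fp_counterpart E p. fp_val V M \<alpha> = 1) \<longleftrightarrow> coherent V M E p"
  by (auto simp: fp_counterpart_def coherent_def fp_val_PrEq)

lemma fp_vars_fp_counterpart:
  "(\<Union>\<alpha>\<in>fp_counterpart E p. fp_vars \<alpha>) = (\<Union>\<psi>\<in>E. cpl_vars \<psi>)"
  by (auto simp: fp_counterpart_def PrEq_def)

lemma not_fp_counterpart_entails_bot_iff:
  assumes "finite V" "(\<Union>\<psi>\<in>E. cpl_vars \<psi>) \<subseteq> V" "fp_vars \<alpha> \<subseteq> V"
  shows "\<not> fp_entails_bot (fp_counterpart E p \<union> {\<alpha>}) \<longleftrightarrow>
    (\<exists>M. prob_model V M \<and> coherent V M E p \<and> fp_val V M \<alpha> = 1)"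
proof -
  have "(\<Union>\<beta>\<in>fp_counterpart E p \<union> {\<alpha>}. fp_vars \<beta>) \<subseteq> V"
    using assms fp_vars_fp_counterpart[of E p] by simp
  then show ?thesis
    by (simp add: not_fp_entails_bot_iff[OF assms(1)] ball_Un fp_val_fp_counterpart
        del: Un_insert_right)
qed

lemma fp_val_Impl_Pr:
  "fp_val V M (Impl (Pr a) (Pr b)) = 1 \<longleftrightarrow> measure M (cpl_ext V a) \<le> measure M (cpl_ext V b)"
  by auto

text \<open>If \<open>Pr a\<close> has value x, then \<open>Delta\<close> of its negation is 1
  exactly when 1 - x = 1. The outer negation therefore expresses that x is nonzero, which means
  positive since measures are nonnegative.\<close>

lemma fp_val_possible:
  "fp_val V M (FNeg (Delta (FNeg (Pr a)))) = 1 \<longleftrightarrow> measure M (cpl_ext V a) > 0"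
  by (auto simp: zero_less_measure_iff)

lemma fp_valid_Impl_Pr_iff: "fp_valid (Impl (Pr a) (Pr b)) \<longleftrightarrow> cpl_entails {a} b"
proof
  assume valid: "fp_valid (Impl (Pr a) (Pr b))"
  show "cpl_entails {a} b"
  proof (rule ccontr)
    assume "\<not> cpl_entails {a} b"
    then obtain v where v: "cpl_sat v a" "\<not> cpl_sat v b"
      by (auto simp: cpl_entails_def)
    define V where "V = cpl_vars a \<union> cpl_vars b"
    \<comment> \<open>Points of a model are subsets of a finite set, so the refuting valuation is
      cut down to the variables of \<open>a\<close> and \<open>b\<close>; their truth values do not
      change.\<close>
    define X where "X = {x\<in>V. v x}"
    define M where "M = return (count_space (Pow V)) X"
    have X: "X \<in> Pow V"
      by (auto simp: X_def)
    have "prob_model V M"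
      using X by (auto simp: prob_model_def M_def V_def finite_cpl_vars intro!: prob_space_return)
    moreover have "fp_vars (Impl (Pr a) (Pr b)) \<subseteq> V"
      by (simp add: V_def)
    ultimately have "measure M (cpl_ext V a) \<le> measure M (cpl_ext V b)"
      using valid unfolding fp_valid_def fp_val_Impl_Pr[symmetric] by blast
    \<comment> \<open>A point mass takes only the values 0 and 1, so the inequality above becomes 1
      \<le> 0.\<close>
    moreover have "measure M (cpl_ext V \<psi>) = indicator (cpl_ext V \<psi>) X" for \<psi>
      unfolding M_def by (rule measure_return) (auto simp: cpl_ext_eq_sat)
    moreover have "cpl_sat (\<lambda>x. x \<in> X) a" "\<not> cpl_sat (\<lambda>x. x \<in> X) b"
      using v cpl_sat_cong[of a "\<lambda>x. x \<in> X" v] cpl_sat_cong[of b "\<lambda>x. x \<in> X" v]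
      by (auto simp: X_def V_def)
    ultimately show False
      using X by (simp add: cpl_ext_eq_sat)
  qed
next
  \<comment> \<open>Entailment makes one extension a subset of the other, and a measure is
    monotone.\<close>
  assume ent: "cpl_entails {a} b"
  show "fp_valid (Impl (Pr a) (Pr b))"
    unfolding fp_valid_def
  proof (intro allI impI)
    fix V M assume "prob_model V M \<and> fp_vars (Impl (Pr a) (Pr b)) \<subseteq> V"
    then interpret prob_space M
      by (simp add: prob_model_def)
    have "sets M = Pow (Pow V)"
      using \<open>prob_model V M \<and> _\<close> by (simp add: prob_model_def)
    then have "measure M (cpl_ext V a) \<le> measure M (cpl_ext V b)"
      using ent by (intro finite_measure_mono) (auto simp: cpl_ext_eq_sat cpl_entails_def)
    then show "fp_val V M (Impl (Pr a) (Pr b)) = 1"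
      unfolding fp_val_Impl_Pr .
  qed
qed

lemma cpl_entails_And: "cpl_entails {And a b} c \<longleftrightarrow> cpl_entails {a, b} c"
  by (simp add: cpl_entails_def)

theorem theorem10:
  fixes \<phi> chi \<tau> :: "'v::countable cpl"
    and H E :: "'v cpl set"
    and p :: "'v cpl \<Rightarrow> unit_rat"
  assumes "prap {\<phi>} chi H E p"
    and "term_over H \<tau>"
  shows "(prap_solution \<phi> chi H E p \<tau> \<longleftrightarrow>
            \<not> fp_entails_bot (fp_counterpart E p \<union> {FNeg (Delta (FNeg (Pr (And \<phi> \<tau>))))}) \<and>
            fp_valid (Impl (Pr (And \<phi> \<tau>)) (Pr chi)))
       \<and> (prap_preferred \<phi> chi H E p \<tau> \<longleftrightarrow>
            \<not> fp_entails_bot (fp_counterpart E p \<union> {FNeg (Delta (FNeg (Pr (And \<phi> \<tau>))))}) \<and>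
            fp_valid (Impl (Pr (And \<phi> \<tau>)) (Pr chi)) \<and>
            (\<forall>\<sigma>. prap_solution \<phi> chi H E p \<sigma> \<longrightarrow>
               \<not> fp_entails_bot (fp_counterpart E p \<union> {Impl (Pr \<sigma>) (Pr \<tau>)})))"
proof -
  define V where "V = prap_vars {\<phi>} chi H E"
  have fin: "finite V"
    using assms(1) by (auto simp: V_def prap_vars_def prap_def finite_cpl_vars)
  have vars: "(\<Union>\<psi>\<in>E. cpl_vars \<psi>) \<subseteq> V" "cpl_vars \<phi> \<subseteq> V" "(\<Union>l\<in>H. cpl_vars l) \<subseteq> V"
    by (auto simp: V_def prap_vars_def)
  \<comment> \<open>Stated for every term over \<open>H\<close>, because rival solutions \<sigma>
    must also be evaluated in models over \<open>V\<close>.\<close>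
  have term_vars: "cpl_vars \<sigma> \<subseteq> V" if "term_over H \<sigma>" for \<sigma>
    using cpl_vars_term_over[OF that] vars(3) by blast
  have "\<not> fp_entails_bot (fp_counterpart E p \<union> {FNeg (Delta (FNeg (Pr (And \<phi> \<tau>))))}) \<longleftrightarrow>
      (\<exists>M. prob_model V M \<and> coherent V M E p \<and> measure M (cpl_ext V (And \<phi> \<tau>)) > 0)"
    using not_fp_counterpart_entails_bot_iff[OF fin vars(1), of "FNeg (Delta (FNeg (Pr (And \<phi> \<tau>))))"]
      vars(2) term_vars[OF assms(2)]
    unfolding fp_val_possible by simp
  then have sol: "prap_solution \<phi> chi H E p \<tau> \<longleftrightarrow>
      \<not> fp_entails_bot (fp_counterpart E p \<union> {FNeg (Delta (FNeg (Pr (And \<phi> \<tau>))))}) \<and>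
      fp_valid (Impl (Pr (And \<phi> \<tau>)) (Pr chi))"
    using assms(2)
    unfolding prap_solution_def Let_def V_def[symmetric] fp_valid_Impl_Pr_iff cpl_entails_And
    by blast
  have pref: "\<not> fp_entails_bot (fp_counterpart E p \<union> {Impl (Pr \<sigma>) (Pr \<tau>)}) \<longleftrightarrow>
      (\<exists>M. prob_model V M \<and> coherent V M E p \<and>
           measure M (cpl_ext V \<tau>) \<ge> measure M (cpl_ext V \<sigma>))"
    if "prap_solution \<phi> chi H E p \<sigma>" for \<sigma>
  proof -
    have "term_over H \<sigma>"
      using that by (simp add: prap_solution_def Let_def)
    then show ?thesis
      using not_fp_counterpart_entails_bot_iff[OF fin vars(1), of "Impl (Pr \<sigma>) (Pr \<tau>)"]
        term_vars assms(2)
      unfolding fp_val_Impl_Pr by simp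
  qed
  \<comment> \<open>\<open>prap_preferred\<close> ranges over \<sigma> different from \<tau>, while
    the claim ranges over all solutions. For \<sigma> = \<tau> the inequality is reflexive, so any
    coherent model suffices, and \<tau> being a solution provides one.\<close>
  have "\<exists>M. prob_model V M \<and> coherent V M E p" if "prap_solution \<phi> chi H E p \<tau>"
    using that by (auto simp: prap_solution_def Let_def V_def)
  then have "prap_preferred \<phi> chi H E p \<tau> \<longleftrightarrow> prap_solution \<phi> chi H E p \<tau> \<and>
      (\<forall>\<sigma>. prap_solution \<phi> chi H E p \<sigma> \<longrightarrow>
        \<not> fp_entails_bot (fp_counterpart E p \<union> {Impl (Pr \<sigma>) (Pr \<tau>)}))"
    unfolding prap_preferred_def Let_def V_def[symmetric] using pref by (metis order_refl)
  with sol show ?thesis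
    by blast
qed

end
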